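(* Let $t$ be a cycle type of size $n$, and let $\mathfrak{s}\in\mathfrak{S}_n$ be an arbitrary fixed $t$-cyclic permutation. Let $(U_i)_{i\in[n]}$ be a sequence of i.i.d. random variables uniform on $[0,1]$. Set $Z_i := (U_i,U_{\mathfrak{s}(i)})$ for each $i\in[n]$, and $\mathcal{P}:=\{Z_i : i\in[n]\}$. Then $\tau:=\mathrm{Perm}(\mathcal{P})$ (which is almost surely well defined) is a uniformly random $t$-cyclic permutation.
   Context: $[n]=\{1,\dots,n\}$ and $\mathfrak{S}_n$ is the set of permutations of $[n]$. A cycle type of size $n$ is a sequence $t=(t_1,\dots,t_n)$ of nonnegative integers with $\sum_{p=1}^n p\,t_p=n$; a permutation of $[n]$ is $t$-cyclic if it has exactly $t_p$ cycles of length $p$ for every $p$ (fixed points are $1$-cycles). For a finite set $\mathcal{P}\subset\mathbb{R}^2$ of $n$ points with pairwise distinct x-coordinates and pairwise distinct y-coordinates, $\mathrm{Perm}(\mathcal{P})$ is the permutation $\tau$ of $[n]$ such that $\tau(i)=j$ when the $i$-th point of $\mathcal{P}$ from the left is the $j$-th point of $\mathcal{P}$ from the bottom. *)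

theory Defs
  imports "HOL-Probability.Probability" "HOL-Combinatorics.Orbits"
begin

text \<open>A sequence \<open>(t\<^sub>1, \<dots>, t\<^sub>n)\<close> is a function on \<open>nat\<close> whose values outside \<open>{1..n}\<close> are
  never used.\<close>

definition cycle_type :: "nat \<Rightarrow> (nat \<Rightarrow> nat) \<Rightarrow> bool" where
  "cycle_type n t \<longleftrightarrow> (\<Sum>p=1..n. p * t p) = n"

text \<open>For a permutation of a finite set, the (supports of the) cycles are the orbits;
  the orbit of a fixed point \<open>i\<close> is \<open>{i}\<close>.\<close>

definition cycles_of_length :: "nat \<Rightarrow> (nat \<Rightarrow> nat) \<Rightarrow> nat \<Rightarrow> nat set set" where
  "cycles_of_length n s p = {C \<in> orbit s ` {1..n}. card C = p}"

definition type_cyclic :: "nat \<Rightarrow> (nat \<Rightarrow> nat) \<Rightarrow> (nat \<Rightarrow> nat) \<Rightarrow> bool" where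
  "type_cyclic n t s \<longleftrightarrow>
     s permutes {1..n} \<and> (\<forall>p\<in>{1..n}. card (cycles_of_length n s p) = t p)"

definition distinct_coordinates :: "(real \<times> real) set \<Rightarrow> bool" where
  "distinct_coordinates P \<longleftrightarrow> finite P \<and> inj_on fst P \<and> inj_on snd P"

definition rank_from_left :: "(real \<times> real) set \<Rightarrow> real \<times> real \<Rightarrow> nat" where
  "rank_from_left P z = card {w \<in> P. fst w \<le> fst z}"

definition rank_from_bottom :: "(real \<times> real) set \<Rightarrow> real \<times> real \<Rightarrow> nat" where
  "rank_from_bottom P z = card {w \<in> P. snd w \<le> snd z}"

text \<open>Meaningful only under \<open>distinct_coordinates P\<close>. As usual for \<open>(permutes)\<close>, the
  permutation is extended by the identity outside \<open>{1..card P}\<close>.\<close>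

definition Perm :: "(real \<times> real) set \<Rightarrow> nat \<Rightarrow> nat" where
  "Perm P i =
     (if i \<in> {1..card P}
      then THE j. \<exists>z\<in>P. rank_from_left P z = i \<and> rank_from_bottom P z = j
      else i)"

end

theory Submission
  imports Defs
begin

text \<open>Let \<open>\<rho>(i)\<close> be the rank of \<open>U\<^sub>i\<close> among \<open>U\<^sub>1, \<dots>, U\<^sub>n\<close>. As the uniform law has no atoms, the
  \<open>U\<^sub>i\<close> are almost surely pairwise distinct, and then \<open>\<rho>\<close> is a permutation and the point \<open>(U\<^sub>i, U\<^bsub>s(i)\<^esub>)\<close> is the \<open>\<rho>(i)\<close>-th from the
  left and the \<open>\<rho>(s(i))\<close>-th from the bottom. So \<open>\<tau> \<circ> \<rho> = \<rho> \<circ> s\<close>: the permutation \<open>\<tau>\<close> is the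
  conjugate of \<open>s\<close> by \<open>\<rho>\<close> (\<open>Perm_points_eq_conjugate\<close>).

  The joint law of the \<open>U\<^sub>i\<close> does not change when the indices are permuted by \<open>\<pi>\<close>, which replaces
  \<open>\<rho>\<close> by \<open>\<rho> \<circ> \<pi>\<close>. Hence all values of \<open>\<rho>\<close> are equally likely (\<open>rank_perm_uniform\<close>). Finally, the conjugate of \<open>s\<close> by a uniformly random
  permutation has a law that is invariant under conjugation, and the permutations of a given cycle
  type form a single conjugacy class (\<open>conjugate_if_same_cycle_counts\<close>), so that law is uniform on
  the class (\<open>random_conjugate_uniform\<close>).

  Measurability of \<open>\<tau>\<close> has to hold on the whole probability space, ties included. It follows from
  the fact that \<open>\<tau>\<close> depends only on which of the finitely many comparisons \<open>U\<^sub>i \<le> U\<^sub>j\<close> hold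
  (\<open>Perm_points_cong\<close>, \<open>measurable_if_determined_by_order\<close>).\<close>

section \<open>Permutations with equally many cycles of each length are conjugate\<close>

text \<open>On the orbit of \<open>x\<close> the map \<open>f\<close> acts as the successor modulo the orbit size.\<close>

lemma funpow_eq_iff_mod_card_orbit:
  assumes "x \<in> orbit f x"
  shows "(f ^^ i) x = (f ^^ j) x \<longleftrightarrow> i mod card (orbit f x) = j mod card (orbit f x)"
proof -
  define d where "d = funpow_dist1 f x x"
  have inj: "inj_on (\<lambda>k. (f ^^ k) x) {0..<d}"
    unfolding d_def by (rule inj_on_funpow_dist1[OF assms])
  have "orbit f x = (\<lambda>k. (f ^^ k) x) ` {0..<d}"
    unfolding d_def by (rule orbit_conv_funpow_dist1[OF assms])
  then have card: "card (orbit f x) = d"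
    using card_image[OF inj] by simp
  have period: "(f ^^ d) x = x"
    unfolding d_def by (rule funpow_dist1_prop[OF assms])
  have "d > 0" by (simp add: d_def)
  have "(f ^^ i) x = (f ^^ j) x \<longleftrightarrow> (f ^^ (i mod d)) x = (f ^^ (j mod d)) x"
    by (simp add: funpow_mod_eq[OF period])
  also have "\<dots> \<longleftrightarrow> i mod d = j mod d"
    using inj_on_eq_iff[OF inj] \<open>d > 0\<close> by simp
  finally show ?thesis unfolding card .
qed

text \<open>Choose a base point in each cycle and send \<open>f\<^sup>i(c)\<close> to \<open>g\<^sup>i(d)\<close>. Equality of two iterates is
  decided by the exponents modulo the common cycle length, so this is well defined and injective.\<close>

lemma cyclic_on_same_card_intertwined:
  assumes C: "cyclic_on f C" and D: "cyclic_on g D" and card: "card C = card D"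
  obtains h where "bij_betw h C D" "\<And>x. x \<in> C \<Longrightarrow> h (f x) = g (h x)"
proof -
  obtain c where c: "c \<in> C" "C = orbit f c" using C by (auto simp: cyclic_on_def)
  obtain d where d: "d \<in> D" "D = orbit g d" using D by (auto simp: cyclic_on_def)
  define e where "e = (\<lambda>i. (f ^^ i) c)"
  define e' where "e' = (\<lambda>i. (g ^^ i) d)"
  have range_e: "range e = C"
    using orbit_altdef_self_in[of c f] c unfolding e_def by auto
  have range_e': "range e' = D"
    using orbit_altdef_self_in[of d g] d unfolding e'_def by auto
  have kernel: "e i = e j \<longleftrightarrow> e' i = e' j" for i j
    unfolding e_def e'_def
    using funpow_eq_iff_mod_card_orbit[of c f] funpow_eq_iff_mod_card_orbit[of d g] c d card
    by metis
  define h where "h x = e' (SOME i. e i = x)" for x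
  have h: "h (e i) = e' i" for i
  proof -
    have "e (SOME k. e k = e i) = e i" by (rule someI) simp
    then show ?thesis unfolding h_def kernel .
  qed
  have "inj_on h C"
    unfolding range_e[symmetric] by (auto intro!: inj_onI simp: h kernel)
  moreover have "h ` C = D"
    unfolding range_e[symmetric] range_e'[symmetric] by (auto simp: h image_image)
  moreover have "h (f x) = g (h x)" if x: "x \<in> C" for x
  proof -
    obtain i where i: "x = e i" using x range_e by blast
    have "f (e i) = e (Suc i)" "g (e' i) = e' (Suc i)" by (simp_all add: e_def e'_def)
    then show ?thesis using h[of "Suc i"] h[of i] i by simp
  qed
  ultimately show ?thesis using that by (simp add: bij_betw_def)
qed

text \<open>Matches the cycles of one permutation with the equally long cycles of another: the
  bijections between the members of each size \<open>p\<close> are glued together.\<close>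

lemma size_preserving_bij_betw:
  assumes "finite F" "finite G"
    and count: "\<And>p. card {C \<in> F. card C = p} = card {D \<in> G. card D = p}"
  obtains \<phi> where "bij_betw \<phi> F G" "\<And>C. C \<in> F \<Longrightarrow> card (\<phi> C) = card C"
proof -
  have "\<exists>\<phi>. bij_betw \<phi> {C \<in> F. card C = p} {D \<in> G. card D = p}" for p
    by (rule finite_same_card_bij) (use assms in auto)
  then obtain \<phi> where \<phi>: "\<And>p. bij_betw (\<phi> p) {C \<in> F. card C = p} {D \<in> G. card D = p}"
    by metis
  define \<psi> where "\<psi> C = \<phi> (card C) C" for C
  have \<psi>: "\<psi> C \<in> G" "card (\<psi> C) = card C" if "C \<in> F" for C
    using bij_betwE[OF \<phi>[of "card C"]] that by (auto simp: \<psi>_def)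
  have "inj_on \<psi> F"
  proof (rule inj_onI)
    fix C C' assume *: "C \<in> F" "C' \<in> F" "\<psi> C = \<psi> C'"
    then have "card C = card C'" using \<psi> by metis
    then show "C = C'"
      using * bij_betw_imp_inj_on[OF \<phi>[of "card C"]] by (auto simp: \<psi>_def dest: inj_onD)
  qed
  moreover have "G \<subseteq> \<psi> ` F"
  proof
    fix D assume "D \<in> G"
    then have "D \<in> \<phi> (card D) ` {C \<in> F. card C = card D}"
      using bij_betw_imp_surj_on[OF \<phi>[of "card D"]] by blast
    then show "D \<in> \<psi> ` F" by (force simp: \<psi>_def)
  qed
  ultimately have "bij_betw \<psi> F G" using \<psi>(1) by (auto simp: bij_betw_def)
  then show ?thesis using that \<psi>(2) by blast
qed

lemma orbits_eq_if_meet: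
  assumes "f permutes A" "finite A" "C \<in> orbit f ` A" "C' \<in> orbit f ` A" "x \<in> C" "x \<in> C'"
  shows "C = C'"
proof -
  have "orbit f x = C" "orbit f x = C'"
    using assms cyclic_on_orbit[OF assms(1,2)] by (auto intro!: orbit_cyclic_eq3)
  then show ?thesis by simp
qed

lemma Union_orbits:
  assumes "f permutes A" "finite A"
  shows "\<Union> (orbit f ` A) = A"
proof -
  have "permutation f" using assms by (auto simp: permutation_permutes)
  then show ?thesis
    using permutes_orbit_subset[OF assms(1)] permutation_self_in_orbit by fastforce
qed

text \<open>The cycles are matched length by length, and each is mapped onto its partner
  compatibly with the two cyclic actions. Since the cycles partition \<open>A\<close>, these maps fit together
  to one permutation of \<open>A\<close>.\<close>

lemma conjugate_if_same_cycle_counts: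
  assumes f: "f permutes A" and g: "g permutes A" and A: "finite A"
    and count: "\<And>p. card {C \<in> orbit f ` A. card C = p} = card {D \<in> orbit g ` A. card D = p}"
  obtains h where "h permutes A" "g = h \<circ> f \<circ> inv h"
proof -
  obtain \<phi> where \<phi>: "bij_betw \<phi> (orbit f ` A) (orbit g ` A)"
      and card: "\<And>C. C \<in> orbit f ` A \<Longrightarrow> card (\<phi> C) = card C"
    using size_preserving_bij_betw[of "orbit f ` A" "orbit g ` A"] A count by blast
  have "\<exists>h. bij_betw h C (\<phi> C) \<and> (\<forall>x\<in>C. h (f x) = g (h x))" if C: "C \<in> orbit f ` A" for C
  proof -
    have "cyclic_on f C" using C cyclic_on_orbit[OF f A] by auto
    moreover have "cyclic_on g (\<phi> C)"
      using bij_betwE[OF \<phi>] C cyclic_on_orbit[OF g A] by fastforce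
    ultimately show ?thesis
      using cyclic_on_same_card_intertwined[of f C g "\<phi> C"] card[OF C] by metis
  qed
  then obtain H where H: "\<And>C. C \<in> orbit f ` A \<Longrightarrow> bij_betw (H C) C (\<phi> C)"
      and twist: "\<And>C x. C \<in> orbit f ` A \<Longrightarrow> x \<in> C \<Longrightarrow> H C (f x) = g (H C x)"
    by metis
  define h where "h x = (if x \<in> A then H (orbit f x) x else x)" for x
  have self: "x \<in> orbit f x" for x
    using f A by (intro permutation_self_in_orbit) (auto simp: permutation_permutes)
  have h_orbit: "h x \<in> \<phi> (orbit f x)" if "x \<in> A" for x
    using bij_betwE[OF H[of "orbit f x"]] that self by (auto simp: h_def)
  have orbit_of: "orbit f x = C" if "C \<in> orbit f ` A" "x \<in> C" for x C
    using that cyclic_on_orbit[OF f A] orbit_cyclic_eq3 by fastforce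
  have "inj_on h A"
  proof (rule inj_onI)
    fix x y assume *: "x \<in> A" "y \<in> A" "h x = h y"
    have "\<phi> (orbit f x) \<in> orbit g ` A" "\<phi> (orbit f y) \<in> orbit g ` A"
      using bij_betwE[OF \<phi>] * by auto
    then have "\<phi> (orbit f x) = \<phi> (orbit f y)"
      using orbits_eq_if_meet[OF g A] h_orbit * by metis
    then have eq: "orbit f x = orbit f y"
      using bij_betw_imp_inj_on[OF \<phi>] * by (auto dest: inj_onD)
    then have "y \<in> orbit f x" using self by simp
    then show "x = y"
      using bij_betw_imp_inj_on[OF H[of "orbit f x"]] * eq self
      by (auto simp: h_def dest: inj_onD)
  qed
  moreover have "A \<subseteq> h ` A"
  proof
    fix y assume "y \<in> A"
    then obtain D where D: "D \<in> orbit g ` A" "y \<in> D" using Union_orbits[OF g A] by blast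
    then obtain C where C: "C \<in> orbit f ` A" "D = \<phi> C"
      using bij_betw_imp_surj_on[OF \<phi>] by blast
    then obtain x where x: "x \<in> C" "y = H C x"
      using bij_betw_imp_surj_on[OF H[OF C(1)]] D(2) by blast
    moreover have "x \<in> A" using x C Union_orbits[OF f A] by blast
    ultimately show "y \<in> h ` A" using orbit_of[OF C(1)] by (auto simp: h_def)
  qed
  moreover have "h ` A \<subseteq> A"
    using h_orbit bij_betwE[OF \<phi>] Union_orbits[OF g A] by blast
  ultimately have h: "h permutes A"
    by (intro bij_imp_permutes) (auto simp: bij_betw_def h_def)
  have intertwines: "h (f x) = g (h x)" for x
  proof (cases "x \<in> A")
    case True
    then have "f x \<in> A" using f by (simp add: permutes_in_image)
    moreover have "orbit f (f x) = orbit f x" using self by (rule self_in_orbit_step)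
    ultimately show ?thesis using True twist[of "orbit f x" x] self by (simp add: h_def)
  next
    case False
    then show ?thesis using f g by (simp add: permutes_not_in h_def)
  qed
  have "g = h \<circ> f \<circ> inv h"
    by (simp add: fun_eq_iff intertwines permutes_inverses[OF h])
  then show ?thesis using that h by blast
qed

section \<open>Conjugating by a uniformly random permutation\<close>

text \<open>Conjugation by \<open>\<alpha>\<close> carries the cycles of \<open>s\<close> to their images under \<open>\<alpha>\<close>, which have
  the same lengths.\<close>

lemma type_cyclic_conjugate:
  assumes s: "type_cyclic n t s" and \<alpha>: "\<alpha> permutes {1..n}"
  shows "type_cyclic n t (\<alpha> \<circ> s \<circ> inv \<alpha>)"
proof -
  let ?\<sigma> = "\<alpha> \<circ> s \<circ> inv \<alpha>"
  have s_perm: "s permutes {1..n}" using s by (simp add: type_cyclic_def)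
  have perm: "?\<sigma> permutes {1..n}"
    using s_perm \<alpha> by (intro permutes_compose permutes_inv)
  have "\<alpha> ` orbit s x = orbit ?\<sigma> (\<alpha> x)" for x
  proof (rule orbit_inverse)
    show "x \<in> orbit s x"
      using s_perm by (intro permutation_self_in_orbit) (auto simp: permutation_permutes)
  qed (simp add: permutes_inverses[OF \<alpha>])
  then have "orbit ?\<sigma> ` \<alpha> ` {1..n} = image \<alpha> ` orbit s ` {1..n}"
    by (simp add: image_image)
  then have orbits: "orbit ?\<sigma> ` {1..n} = image \<alpha> ` orbit s ` {1..n}"
    by (simp only: permutes_image[OF \<alpha>])
  have "cycles_of_length n ?\<sigma> p = image \<alpha> ` cycles_of_length n s p" for p
    unfolding cycles_of_length_def orbits
    using card_image[OF inj_on_subset[OF permutes_inj[OF \<alpha>]]] by auto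
  moreover have "inj_on (image \<alpha>) \<C>" for \<C>
    by (rule inj_onI) (simp add: inj_image_eq_iff[OF permutes_inj[OF \<alpha>]])
  ultimately have "card (cycles_of_length n ?\<sigma> p) = card (cycles_of_length n s p)" for p
    by (simp add: card_image)
  then show ?thesis using s perm by (simp add: type_cyclic_def)
qed

lemma type_cyclic_imp_conjugate:
  assumes "type_cyclic n t s" "type_cyclic n t \<sigma>"
  obtains \<pi> where "\<pi> permutes {1..n}" "\<sigma> = \<pi> \<circ> s \<circ> inv \<pi>"
proof (rule conjugate_if_same_cycle_counts)
  show s: "s permutes {1..n}" and \<sigma>: "\<sigma> permutes {1..n}"
    using assms by (auto simp: type_cyclic_def)
  \<comment> \<open>The type prescribes the counts for lengths in \<open>{1..n}\<close> only; no other length occurs.\<close>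
  have no_cycles: "{C \<in> orbit f ` {1..n}. card C = p} = {}"
    if f: "f permutes {1..n}" and p: "p \<notin> {1..n}" for f p
  proof -
    have "card (orbit f x) \<in> {1..n}" if "x \<in> {1..n}" for x
    proof -
      have "orbit f x \<subseteq> {1..n}" by (rule permutes_orbit_subset[OF f that])
      then have "finite (orbit f x)" "card (orbit f x) \<le> n"
        using finite_subset card_mono[of "{1..n}" "orbit f x"] by auto
      then show ?thesis using orbit_nonempty[of f x] by (simp add: Suc_le_eq card_gt_0_iff)
    qed
    then show ?thesis using p by auto
  qed
  show "card {C \<in> orbit s ` {1..n}. card C = p} = card {D \<in> orbit \<sigma> ` {1..n}. card D = p}" for p
  proof (cases "p \<in> {1..n}")
    case True
    then show ?thesis using assms by (simp add: type_cyclic_def cycles_of_length_def)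
  next
    case False
    then show ?thesis by (simp only: no_cycles[OF s False] no_cycles[OF \<sigma> False])
  qed
qed simp_all

text \<open>Serves both for the law of the random conjugate of \<open>s\<close> and for that of the ranks; in each
  case a symmetry argument supplies the equality of the point masses.\<close>

lemma prob_space_eq_pmf_of_set:
  assumes "prob_space N" and sets: "sets N = UNIV" and "finite A"
    and supp: "AE x in N. x \<in> A"
    and const: "\<And>x y. x \<in> A \<Longrightarrow> y \<in> A \<Longrightarrow> measure N {x} = measure N {y}"
  shows "N = measure_pmf (pmf_of_set A)"
proof -
  interpret N: prob_space N by fact
  have total: "(\<Sum>x\<in>A. measure N {x}) = 1"
  proof -
    have "measure N A = 1"
      using supp by (subst N.prob_eq_1) (auto simp: sets)
    then show ?thesis
      using N.finite_measure_eq_sum_singleton[of A] \<open>finite A\<close> sets by simp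
  qed
  then have "A \<noteq> {}" by auto
  have single: "measure N {x} = 1 / card A" if "x \<in> A" for x
  proof -
    have "(\<Sum>y\<in>A. measure N {y}) = (\<Sum>y\<in>A. measure N {x})"
      by (rule sum.cong[OF refl]) (rule const[OF _ that])
    then show ?thesis using total \<open>A \<noteq> {}\<close> \<open>finite A\<close> by (simp add: field_simps)
  qed
  show ?thesis
  proof (rule measure_eqI_countable_AE[where \<Omega> = A])
    fix x assume "x \<in> A"
    then show "emeasure N {x} = emeasure (measure_pmf (pmf_of_set A)) {x}"
      using \<open>A \<noteq> {}\<close> \<open>finite A\<close>
      by (simp add: N.emeasure_eq_measure single emeasure_pmf_single)
  qed (simp_all add: sets supp AE_measure_pmf_iff countable_finite \<open>A \<noteq> {}\<close> \<open>finite A\<close>)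
qed

text \<open>Left multiplication by \<open>\<pi>\<close> preserves the uniform law on all permutations, so conjugation
  by \<open>\<pi>\<close> preserves the law of the random conjugate. As any two \<open>t\<close>-cyclic permutations are
  conjugate, all of them get the same weight.\<close>

lemma random_conjugate_uniform:
  assumes s: "type_cyclic n t s"
  shows "map_pmf (\<lambda>\<alpha>. \<alpha> \<circ> s \<circ> inv \<alpha>) (pmf_of_set {\<alpha>. \<alpha> permutes {1..n}})
       = pmf_of_set {\<sigma>. type_cyclic n t \<sigma>}"
    (is "map_pmf ?conj (pmf_of_set ?S) = pmf_of_set ?T")
proof -
  let ?D = "map_pmf ?conj (pmf_of_set ?S)"
  have fin: "finite ?S" by (simp add: finite_permutations)
  have ne: "?S \<noteq> {}" using permutes_id by blast
  have invariant: "map_pmf (\<lambda>\<sigma>. \<pi> \<circ> \<sigma> \<circ> inv \<pi>) ?D = ?D" if \<pi>: "\<pi> permutes {1..n}" for \<pi>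
  proof -
    have "bij_betw (\<lambda>\<alpha>. \<pi> \<circ> \<alpha>) ?S ?S"
    proof (rule bij_betw_byWitness[where f' = "\<lambda>\<alpha>. inv \<pi> \<circ> \<alpha>"])
      show "(\<lambda>\<alpha>. \<pi> \<circ> \<alpha>) ` ?S \<subseteq> ?S" "(\<lambda>\<alpha>. inv \<pi> \<circ> \<alpha>) ` ?S \<subseteq> ?S"
        using permutes_compose \<pi> permutes_inv[OF \<pi>] by blast+
    qed (simp_all add: o_assoc permutes_inv_o[OF \<pi>])
    then have shift: "map_pmf (\<lambda>\<alpha>. \<pi> \<circ> \<alpha>) (pmf_of_set ?S) = pmf_of_set ?S"
      using ne fin by (rule map_pmf_of_set_bij_betw)
    have "map_pmf (\<lambda>\<sigma>. \<pi> \<circ> \<sigma> \<circ> inv \<pi>) ?D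
        = map_pmf (\<lambda>\<alpha>. \<pi> \<circ> (\<alpha> \<circ> s \<circ> inv \<alpha>) \<circ> inv \<pi>) (pmf_of_set ?S)"
      by (simp add: pmf.map_comp comp_def)
    also have "\<dots> = map_pmf (\<lambda>\<alpha>. ?conj (\<pi> \<circ> \<alpha>)) (pmf_of_set ?S)"
    proof (rule map_pmf_cong[OF refl])
      fix \<alpha> assume "\<alpha> \<in> set_pmf (pmf_of_set ?S)"
      then have "\<alpha> permutes {1..n}" using fin ne by simp
      then have "inv (\<pi> \<circ> \<alpha>) = inv \<alpha> \<circ> inv \<pi>"
        using \<pi> by (simp add: o_inv_distrib permutes_bij)
      then show "\<pi> \<circ> (\<alpha> \<circ> s \<circ> inv \<alpha>) \<circ> inv \<pi> = ?conj (\<pi> \<circ> \<alpha>)"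
        by (simp add: o_assoc)
    qed
    also have "\<dots> = map_pmf ?conj (map_pmf (\<lambda>\<alpha>. \<pi> \<circ> \<alpha>) (pmf_of_set ?S))"
      by (simp add: pmf.map_comp comp_def)
    finally show ?thesis unfolding shift .
  qed
  have "measure_pmf ?D = measure_pmf (pmf_of_set ?T)"
  proof (rule prob_space_eq_pmf_of_set)
    show "prob_space (measure_pmf ?D)" by (rule measure_pmf.prob_space_axioms)
    show "finite ?T" by (rule finite_subset[OF _ fin]) (auto simp: type_cyclic_def)
    show "AE \<sigma> in measure_pmf ?D. \<sigma> \<in> ?T"
      using fin ne type_cyclic_conjugate[OF s] by (auto simp: AE_measure_pmf_iff)
    fix \<sigma> \<sigma>' assume "\<sigma> \<in> ?T" "\<sigma>' \<in> ?T"
    then obtain \<pi> where \<pi>: "\<pi> permutes {1..n}" and \<sigma>': "\<sigma>' = \<pi> \<circ> \<sigma> \<circ> inv \<pi>"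
      using type_cyclic_imp_conjugate by blast
    have inj: "inj (\<lambda>\<sigma>. \<pi> \<circ> \<sigma> \<circ> inv \<pi>)"
    proof (rule inj_on_inverseI)
      fix \<sigma>
      have "inv \<pi> \<circ> (\<pi> \<circ> \<sigma> \<circ> inv \<pi>) \<circ> \<pi> = (inv \<pi> \<circ> \<pi>) \<circ> \<sigma> \<circ> (inv \<pi> \<circ> \<pi>)"
        by (simp only: o_assoc)
      then show "inv \<pi> \<circ> (\<pi> \<circ> \<sigma> \<circ> inv \<pi>) \<circ> \<pi> = \<sigma>" by (simp add: permutes_inv_o[OF \<pi>])
    qed
    have "pmf ?D \<sigma> = pmf (map_pmf (\<lambda>\<sigma>. \<pi> \<circ> \<sigma> \<circ> inv \<pi>) ?D) \<sigma>'"
      unfolding \<sigma>' by (rule pmf_map_inj'[OF inj, symmetric])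
    also have "\<dots> = pmf ?D \<sigma>'" unfolding invariant[OF \<pi>] ..
    finally show "measure (measure_pmf ?D) {\<sigma>} = measure (measure_pmf ?D) {\<sigma>'}"
      by (simp add: measure_pmf_single)
  qed simp
  then show ?thesis by (simp add: measure_pmf_inject)
qed
section \<open>Rank permutations\<close>

definition rank_perm :: "nat \<Rightarrow> (nat \<Rightarrow> real) \<Rightarrow> nat \<Rightarrow> nat" where
  "rank_perm n u i = (if i \<in> {1..n} then card {j \<in> {1..n}. u j \<le> u i} else i)"

lemma rank_perm_permutes:
  assumes inj: "inj_on u {1..n}"
  shows "rank_perm n u permutes {1..n}"
proof -
  have less: "rank_perm n u i < rank_perm n u j"
    if "i \<in> {1..n}" "j \<in> {1..n}" "u i < u j" for i j
  proof -
    have "{k \<in> {1..n}. u k \<le> u i} \<subset> {k \<in> {1..n}. u k \<le> u j}"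
    proof (rule psubsetI)
      show "{k \<in> {1..n}. u k \<le> u i} \<subseteq> {k \<in> {1..n}. u k \<le> u j}"
        using that by auto
      have "j \<in> {k \<in> {1..n}. u k \<le> u j} - {k \<in> {1..n}. u k \<le> u i}"
        using that by simp
      then show "{k \<in> {1..n}. u k \<le> u i} \<noteq> {k \<in> {1..n}. u k \<le> u j}" by blast
    qed
    then show ?thesis using that by (simp add: rank_perm_def psubset_card_mono)
  qed
  have "inj_on (rank_perm n u) {1..n}"
  proof (rule inj_onI)
    fix i j assume ij: "i \<in> {1..n}" "j \<in> {1..n}" "rank_perm n u i = rank_perm n u j"
    then have "u i = u j" using less[of i j] less[of j i] by (metis less_irrefl linorder_less_linear)
    then show "i = j" using inj ij by (auto dest: inj_onD)
  qed
  moreover have "rank_perm n u ` {1..n} \<subseteq> {1..n}"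
  proof (rule image_subsetI)
    fix i assume i: "i \<in> {1..n}"
    then have "i \<in> {j \<in> {1..n}. u j \<le> u i}" by simp
    then have "card {j \<in> {1..n}. u j \<le> u i} > 0" by (auto simp: card_gt_0_iff)
    moreover have "card {j \<in> {1..n}. u j \<le> u i} \<le> card {1..n}" by (rule card_mono) auto
    ultimately show "rank_perm n u i \<in> {1..n}" using i by (simp add: rank_perm_def)
  qed
  ultimately have "bij_betw (rank_perm n u) {1..n} {1..n}"
    by (simp add: bij_betw_def endo_inj_surj)
  then show ?thesis by (rule bij_imp_permutes) (auto simp: rank_perm_def)
qed

lemma card_reindex_permutes:
  assumes "\<pi> permutes A"
  shows "card {j \<in> A. Q (\<pi> j)} = card {j \<in> A. Q j}"
proof -
  have "bij_betw \<pi> {j \<in> A. Q (\<pi> j)} {j \<in> A. Q j}"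
    using assms
    by (intro bij_betw_byWitness[where f' = "inv \<pi>"])
      (auto simp: permutes_inverses permutes_in_image permutes_in_image[OF permutes_inv])
  then show ?thesis by (rule bij_betw_same_card)
qed

lemma rank_perm_reindex:
  assumes \<pi>: "\<pi> permutes {1..n}"
  shows "rank_perm n (\<lambda>i. u (\<pi> i)) = rank_perm n u \<circ> \<pi>"
proof
  fix i
  show "rank_perm n (\<lambda>i. u (\<pi> i)) i = (rank_perm n u \<circ> \<pi>) i"
  proof (cases "i \<in> {1..n}")
    case True
    then have "\<pi> i \<in> {1..n}" using \<pi> by (simp only: permutes_in_image)
    then show ?thesis
      using card_reindex_permutes[OF \<pi>, of "\<lambda>j. u j \<le> u (\<pi> i)"] True by (simp add: rank_perm_def)
  next
    case False
    then show ?thesis using permutes_not_in[OF \<pi> False] by (auto simp: rank_perm_def)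
  qed
qed

lemma rank_perm_cong:
  assumes "\<And>i j. i \<in> {1..n} \<Longrightarrow> j \<in> {1..n} \<Longrightarrow> u i \<le> u j \<longleftrightarrow> v i \<le> v j"
  shows "rank_perm n u = rank_perm n v"
proof
  fix i
  have "i \<in> {1..n} \<Longrightarrow> {j \<in> {1..n}. u j \<le> u i} = {j \<in> {1..n}. v j \<le> v i}"
    using assms by blast
  then show "rank_perm n u i = rank_perm n v i" by (simp add: rank_perm_def del: atLeastAtMost_iff)
qed

text \<open>The point set \<open>P\<close> of the theorem for one outcome \<open>u\<close> of the random variables.\<close>

abbreviation points :: "nat \<Rightarrow> (nat \<Rightarrow> nat) \<Rightarrow> (nat \<Rightarrow> real) \<Rightarrow> (real \<times> real) set" where
  "points n s u \<equiv> (\<lambda>i. (u i, u (s i))) ` {1..n}"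

lemma points_distinct_coordinates:
  assumes s: "s permutes {1..n}" and inj: "inj_on u {1..n}"
  shows "card (points n s u) = n" "distinct_coordinates (points n s u)"
proof -
  have inj': "inj_on (\<lambda>i. u (s i)) {1..n}"
    using comp_inj_on[of s "{1..n}" u] inj permutes_inj_on[OF s] permutes_image[OF s]
    by (simp add: comp_def)
  have "inj_on (\<lambda>i. (u i, u (s i))) {1..n}"
    using inj by (intro inj_onI) (auto dest: inj_onD)
  then show "card (points n s u) = n" by (simp add: card_image)
  show "distinct_coordinates (points n s u)"
    unfolding distinct_coordinates_def
    using inj_on_imageI[of fst "\<lambda>i. (u i, u (s i))" "{1..n}"]
      inj_on_imageI[of snd "\<lambda>i. (u i, u (s i))" "{1..n}"] inj inj' by (simp add: comp_def)
qed

text \<open>The point with index \<open>i\<close> has left rank \<open>\<rho>(i)\<close>. Its bottom rank is the rank of \<open>u(s(i))\<close>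
  among the values \<open>u(s(j))\<close>, which are the values \<open>u(j)\<close> in another order, so it is \<open>\<rho>(s(i))\<close>.\<close>

lemma Perm_points_eq_conjugate:
  assumes s: "s permutes {1..n}" and inj: "inj_on u {1..n}"
  shows "Perm (points n s u) = rank_perm n u \<circ> s \<circ> inv (rank_perm n u)"
proof
  let ?\<rho> = "rank_perm n u" and ?z = "\<lambda>i. (u i, u (s i))"
  have \<rho>: "?\<rho> permutes {1..n}" by (rule rank_perm_permutes[OF inj])
  have inj_z: "inj_on ?z J" if "J \<subseteq> {1..n}" for J
    using inj that by (intro inj_onI) (auto dest: inj_onD)
  have left: "rank_from_left (points n s u) (?z i) = ?\<rho> i" if "i \<in> {1..n}" for i
  proof -
    have "{w \<in> points n s u. fst w \<le> fst (?z i)} = ?z ` {j \<in> {1..n}. u j \<le> u i}" by auto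
    then have "rank_from_left (points n s u) (?z i) = card {j \<in> {1..n}. u j \<le> u i}"
      unfolding rank_from_left_def by (simp only:) (rule card_image[OF inj_z], auto)
    then show ?thesis using that by (simp add: rank_perm_def)
  qed
  have bottom: "rank_from_bottom (points n s u) (?z i) = ?\<rho> (s i)" if "i \<in> {1..n}" for i
  proof -
    have "{w \<in> points n s u. snd w \<le> snd (?z i)} = ?z ` {j \<in> {1..n}. u (s j) \<le> u (s i)}" by auto
    then have "rank_from_bottom (points n s u) (?z i) = card {j \<in> {1..n}. u (s j) \<le> u (s i)}"
      unfolding rank_from_bottom_def by (simp only:) (rule card_image[OF inj_z], auto)
    also have "\<dots> = rank_perm n (\<lambda>i. u (s i)) i" using that by (simp add: rank_perm_def)
    finally show ?thesis by (simp add: rank_perm_reindex[OF s])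
  qed
  fix k
  show "Perm (points n s u) k = (?\<rho> \<circ> s \<circ> inv ?\<rho>) k"
  proof (cases "k \<in> {1..n}")
    case True
    define i where "i = inv ?\<rho> k"
    have i: "i \<in> {1..n}" and k: "?\<rho> i = k"
      using True unfolding i_def
      by (simp_all only: permutes_in_image[OF permutes_inv[OF \<rho>]] permutes_inverses[OF \<rho>])
    have unique: "i' = i" if "?\<rho> i' = k" for i'
      using that k permutes_inj[OF \<rho>] by (auto dest: injD)
    have "(THE j. \<exists>z\<in>points n s u. rank_from_left (points n s u) z = k
            \<and> rank_from_bottom (points n s u) z = j) = ?\<rho> (s i)"
    proof (rule the_equality)
      show "\<exists>z\<in>points n s u. rank_from_left (points n s u) z = k
            \<and> rank_from_bottom (points n s u) z = ?\<rho> (s i)"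
        using left[OF i] bottom[OF i] i k by (intro bexI[of _ "?z i"]) auto
    next
      fix j assume "\<exists>z\<in>points n s u. rank_from_left (points n s u) z = k
            \<and> rank_from_bottom (points n s u) z = j"
      then obtain i' where "i' \<in> {1..n}" "rank_from_left (points n s u) (?z i') = k"
          "rank_from_bottom (points n s u) (?z i') = j"
        by blast
      then show "j = ?\<rho> (s i)" using left bottom unique by metis
    qed
    then show ?thesis
      using True points_distinct_coordinates(1)[OF s inj] by (simp add: Perm_def i_def)
  next
    case False
    note permutes_not_in[OF permutes_inv[OF \<rho>] False] permutes_not_in[OF s False]
      permutes_not_in[OF \<rho> False]
    then show ?thesis
      using False points_distinct_coordinates(1)[OF s inj] by (auto simp: Perm_def)
  qed
qed

lemma card_image_eq_if_same_kernel:
  assumes "\<And>x y. x \<in> A \<Longrightarrow> y \<in> A \<Longrightarrow> f x = f y \<longleftrightarrow> g x = g y"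
  shows "card (f ` A) = card (g ` A)"
proof -
  have "g (inv_into A f (f x)) = g x" if "x \<in> A" for x
    using assms[of "inv_into A f (f x)" x] that by (simp add: inv_into_into f_inv_into_f)
  then have "g ` A = (\<lambda>z. g (inv_into A f z)) ` f ` A"
    by (simp add: image_image)
  moreover have "inj_on (\<lambda>z. g (inv_into A f z)) (f ` A)"
  proof (rule inj_onI)
    fix z z' assume z: "z \<in> f ` A" "z' \<in> f ` A" "g (inv_into A f z) = g (inv_into A f z')"
    then have "f (inv_into A f z) = f (inv_into A f z')"
      using assms inv_into_into by metis
    then show "z = z'" using z by (simp add: f_inv_into_f)
  qed
  ultimately show ?thesis by (simp only: card_image)
qed

text \<open>With ties, points may coincide and the description in \<open>Perm\<close> may fail to be unique, but it
  speaks only of cardinalities of sets of points, and those depend only on the order pattern of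
  \<open>u\<close>.\<close>

lemma Perm_points_cong:
  assumes s: "s permutes {1..n}"
    and ord: "\<And>i j. i \<in> {1..n} \<Longrightarrow> j \<in> {1..n} \<Longrightarrow> u i \<le> u j \<longleftrightarrow> v i \<le> v j"
  shows "Perm (points n s u) = Perm (points n s v)"
proof -
  have s_in: "s i \<in> {1..n}" if "i \<in> {1..n}" for i
    using that by (simp only: permutes_in_image[OF s])
  have eq: "u i = u j \<longleftrightarrow> v i = v j" if "i \<in> {1..n}" "j \<in> {1..n}" for i j
    using ord[OF that] ord[OF that(2,1)] by (simp add: order.eq_iff)
  have card: "card ((\<lambda>i. (u i, u (s i))) ` J) = card ((\<lambda>i. (v i, v (s i))) ` J)"
    if "J \<subseteq> {1..n}" for J
    using that s_in eq by (intro card_image_eq_if_same_kernel) (simp add: subset_iff)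
  have left: "rank_from_left (points n s u) (u i, u (s i))
            = rank_from_left (points n s v) (v i, v (s i))" if i: "i \<in> {1..n}" for i
  proof -
    have "{w \<in> points n s x. fst w \<le> fst (x i, x (s i))}
        = (\<lambda>i. (x i, x (s i))) ` {j \<in> {1..n}. x j \<le> x i}" for x :: "nat \<Rightarrow> real" by auto
    moreover have "{j \<in> {1..n}. u j \<le> u i} = {j \<in> {1..n}. v j \<le> v i}" using ord i by blast
    ultimately show ?thesis unfolding rank_from_left_def by (simp only: card Collect_subset)
  qed
  have bottom: "rank_from_bottom (points n s u) (u i, u (s i))
            = rank_from_bottom (points n s v) (v i, v (s i))" if i: "i \<in> {1..n}" for i
  proof -
    have "{w \<in> points n s x. snd w \<le> snd (x i, x (s i))}
        = (\<lambda>i. (x i, x (s i))) ` {j \<in> {1..n}. x (s j) \<le> x (s i)}" for x :: "nat \<Rightarrow> real" by auto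
    moreover have "{j \<in> {1..n}. u (s j) \<le> u (s i)} = {j \<in> {1..n}. v (s j) \<le> v (s i)}"
      using ord s_in i by blast
    ultimately show ?thesis unfolding rank_from_bottom_def by (simp only: card Collect_subset)
  qed
  have same: "(\<exists>z\<in>points n s u. rank_from_left (points n s u) z = k
            \<and> rank_from_bottom (points n s u) z = j)
    \<longleftrightarrow> (\<exists>z\<in>points n s v. rank_from_left (points n s v) z = k
            \<and> rank_from_bottom (points n s v) z = j)" for k j
    by (simp add: left bottom del: atLeastAtMost_iff One_nat_def cong: bex_cong)
  show ?thesis by (rule ext) (simp only: Perm_def card[OF subset_refl] same)
qed

section \<open>Ranks of independent random variables with a common continuous law\<close>

text \<open>There are only finitely many order patterns, and each of them is a measurable event.\<close>

lemma measurable_if_determined_by_order: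
  fixes U :: "'i \<Rightarrow> 'a \<Rightarrow> real"
  assumes I: "finite I" and U: "\<And>i. i \<in> I \<Longrightarrow> U i \<in> borel_measurable M"
    and det: "\<And>\<omega> \<omega>'. (\<And>i j. i \<in> I \<Longrightarrow> j \<in> I \<Longrightarrow> U i \<omega> \<le> U j \<omega> \<longleftrightarrow> U i \<omega>' \<le> U j \<omega>')
      \<Longrightarrow> f \<omega> = f \<omega>'"
  shows "f \<in> measurable M (count_space UNIV)"
proof (rule measurableI)
  fix B
  \<comment> \<open>the order pattern of the outcome \<open>\<omega>\<close>\<close>
  define pat where "pat \<omega> = {(i, j) \<in> I \<times> I. U i \<omega> \<le> U j \<omega>}" for \<omega>
  have pat_f: "f \<omega> = f \<omega>'" if "pat \<omega> = pat \<omega>'" for \<omega> \<omega>'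
    using that by (intro det) (auto simp: pat_def set_eq_iff)
  have preimage: "f -` B \<inter> space M = (\<Union>R\<in>pat ` (f -` B \<inter> space M). {\<omega> \<in> space M. pat \<omega> = R})"
    by (auto dest: pat_f)
  have "finite (pat ` (f -` B \<inter> space M))"
    by (rule finite_subset[of _ "Pow (I \<times> I)"]) (auto simp: pat_def I)
  moreover have "{\<omega> \<in> space M. pat \<omega> = R} \<in> sets M" if "R \<in> pat ` (f -` B \<inter> space M)" for R
  proof -
    have "R \<subseteq> I \<times> I" using that by (auto simp: pat_def)
    then have "{\<omega> \<in> space M. pat \<omega> = R}
        = {\<omega> \<in> space M. \<forall>i\<in>I. \<forall>j\<in>I. U i \<omega> \<le> U j \<omega> \<longleftrightarrow> (i, j) \<in> R}"
      by (auto simp: pat_def)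
    also have "\<dots> \<in> sets M"
    proof (intro sets.sets_Collect_finite_All I)
      fix i j assume "i \<in> I" "j \<in> I"
      then have [measurable]: "U i \<in> borel_measurable M" "U j \<in> borel_measurable M"
        by (simp_all add: U)
      show "{\<omega> \<in> space M. U i \<omega> \<le> U j \<omega> \<longleftrightarrow> (i, j) \<in> R} \<in> sets M" by measurable
    qed
    finally show ?thesis .
  qed
  ultimately show "f -` B \<inter> space M \<in> sets M" by (subst preimage) (rule sets.finite_UN)
qed simp

text \<open>By independence and Fubini: for each fixed value \<open>x\<close> of \<open>X\<close>, the event \<open>Y = x\<close> is null.\<close>

lemma (in prob_space) AE_neq_if_indep_var:
  fixes X Y :: "'a \<Rightarrow> real"
  assumes indep: "indep_var borel X borel Y"
    and atomless: "\<And>y. emeasure (distr M borel Y) {y} = 0"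
  shows "AE \<omega> in M. X \<omega> \<noteq> Y \<omega>"
proof -
  have [measurable]: "random_variable borel X" "random_variable borel Y"
    and joint: "distr M borel X \<Otimes>\<^sub>M distr M borel Y = distr M (borel \<Otimes>\<^sub>M borel) (\<lambda>\<omega>. (X \<omega>, Y \<omega>))"
    using indep by (simp_all add: indep_var_distribution_eq)
  interpret X: prob_space "distr M borel X" by (rule prob_space_distr) measurable
  interpret Y: prob_space "distr M borel Y" by (rule prob_space_distr) measurable
  interpret pair_sigma_finite "distr M borel X" "distr M borel Y" ..
  have "AE p in distr M borel X \<Otimes>\<^sub>M distr M borel Y. fst p \<noteq> snd p"
  proof (rule AE_pair_measure)
    show "AE x in distr M borel X. AE y in distr M borel Y. fst (x, y) \<noteq> snd (x, y)"
    proof (rule AE_I2)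
      fix x
      have "{x} \<in> null_sets (distr M borel Y)" using atomless by (auto simp: null_sets_def)
      from AE_not_in[OF this] show "AE y in distr M borel Y. fst (x, y) \<noteq> snd (x, y)"
        by eventually_elim auto
    qed
  qed measurable
  then show ?thesis unfolding joint by (subst (asm) AE_distr_iff) auto
qed

lemma (in prob_space) AE_inj_on_if_indep_vars:
  fixes U :: "'i \<Rightarrow> 'a \<Rightarrow> real"
  assumes I: "finite I" and indep: "indep_vars (\<lambda>_. borel) U I"
    and atomless: "\<And>i x. i \<in> I \<Longrightarrow> emeasure (distr M borel (U i)) {x} = 0"
  shows "AE \<omega> in M. inj_on (\<lambda>i. U i \<omega>) I"
proof -
  have "AE \<omega> in M. i \<noteq> j \<longrightarrow> U i \<omega> \<noteq> U j \<omega>" if ij: "i \<in> I" "j \<in> I" for i j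
  proof (cases "i = j")
    case False
    \<comment> \<open>Independence of a pair, as the singleton case of \<open>U i\<close> being independent of a minimum.\<close>
    have "indep_var borel (U i) borel (\<lambda>\<omega>. Min ((\<lambda>k. U k \<omega>) ` {j}))"
      using ij False by (intro indep_vars_Min indep_vars_subset[OF indep]) auto
    then have "AE \<omega> in M. U i \<omega> \<noteq> U j \<omega>"
      using atomless[OF ij(2)] by (intro AE_neq_if_indep_var) simp_all
    then show ?thesis by eventually_elim simp
  qed simp
  then have "AE \<omega> in M. \<forall>i\<in>I. \<forall>j\<in>I. i \<noteq> j \<longrightarrow> U i \<omega> \<noteq> U j \<omega>"
    using I by (simp add: AE_ball_countable countable_finite)
  then show ?thesis by eventually_elim (auto simp: inj_on_def)
qed

lemma rank_perm_measurable:
  assumes "\<And>i. i \<in> {1..n} \<Longrightarrow> U i \<in> borel_measurable M"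
  shows "(\<lambda>\<omega>. rank_perm n (\<lambda>i. U i \<omega>)) \<in> measurable M (count_space UNIV)"
  using assms
  by (intro measurable_if_determined_by_order[of "{1..n}" U] rank_perm_cong) auto

text \<open>The joint law is a power of the common law \<open>N\<close>, and reindexing a product measure with equal
  factors does not change it.\<close>

lemma (in prob_space) iid_exchangeable:
  assumes I: "I \<noteq> {}" and indep: "indep_vars (\<lambda>_. S) U I"
    and law: "\<And>i. i \<in> I \<Longrightarrow> distr M S (U i) = N" and \<pi>: "\<pi> permutes I"
  shows "distr M (Pi\<^sub>M I (\<lambda>_. S)) (\<lambda>\<omega>. \<lambda>i\<in>I. U (\<pi> i) \<omega>)
       = distr M (Pi\<^sub>M I (\<lambda>_. S)) (\<lambda>\<omega>. \<lambda>i\<in>I. U i \<omega>)"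
proof -
  have rv [measurable]: "random_variable S (U i)" if "i \<in> I" for i
    using indep that by (simp add: indep_vars_def)
  obtain i where "i \<in> I" using I by blast
  then have N: "prob_space N" "sets N = sets S"
    using prob_space_distr[OF rv, of i] law[of i] sets_distr[of M S "U i"] by simp_all
  have "distr M (Pi\<^sub>M I (\<lambda>_. S)) (\<lambda>\<omega>. \<lambda>i\<in>I. U i \<omega>) = Pi\<^sub>M I (\<lambda>i. distr M S (U i))"
    using indep_vars_iff_distr_eq_PiM'[OF I rv] indep by simp
  also have "\<dots> = Pi\<^sub>M I (\<lambda>_. N)" using law by (intro PiM_cong) auto
  finally have joint: "distr M (Pi\<^sub>M I (\<lambda>_. S)) (\<lambda>\<omega>. \<lambda>i\<in>I. U i \<omega>) = Pi\<^sub>M I (\<lambda>_. N)" .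
  have \<pi>_in: "\<pi> i \<in> I" if "i \<in> I" for i using that permutes_in_image[OF \<pi>] by simp
  have sets_PiM: "sets (Pi\<^sub>M I (\<lambda>_. N)) = sets (Pi\<^sub>M I (\<lambda>_. S))"
    using N(2) by (intro sets_PiM_cong) auto
  have "distr M (Pi\<^sub>M I (\<lambda>_. S)) (\<lambda>\<omega>. \<lambda>i\<in>I. U (\<pi> i) \<omega>)
      = distr (distr M (Pi\<^sub>M I (\<lambda>_. S)) (\<lambda>\<omega>. \<lambda>i\<in>I. U i \<omega>)) (Pi\<^sub>M I (\<lambda>_. S)) (\<lambda>f. \<lambda>i\<in>I. f (\<pi> i))"
    using \<pi>_in
    by (subst distr_distr)
      (auto intro!: measurable_restrict distr_cong measurable_component_singleton simp: comp_def)
  also have "\<dots> = distr (Pi\<^sub>M I (\<lambda>_. N)) (Pi\<^sub>M I (\<lambda>_. N)) (\<lambda>f. \<lambda>i\<in>I. f (\<pi> i))"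
    unfolding joint by (rule distr_cong[OF refl sets_PiM[symmetric] refl])
  also have "\<dots> = Pi\<^sub>M I (\<lambda>_. N)"
    using distr_PiM_reindex[of I "\<lambda>_. N" \<pi> I] N(1) permutes_inj_on[OF \<pi>] \<pi>_in by auto
  finally show ?thesis unfolding joint .
qed

text \<open>For permutations \<open>\<alpha>\<close>, \<open>\<beta>\<close> put \<open>\<pi> = \<beta>\<^sup>-\<^sup>1 \<circ> \<alpha>\<close>. Reindexing the variables by \<open>\<pi>\<close> turns the
  event \<open>\<rho> = \<beta>\<close> into \<open>\<rho> = \<alpha>\<close>, and exchangeability gives both the same probability.\<close>

lemma (in prob_space) rank_perm_uniform:
  fixes U :: "nat \<Rightarrow> 'a \<Rightarrow> real"
  assumes indep: "indep_vars (\<lambda>_. borel) U {1..n}"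
    and law: "\<And>i. i \<in> {1..n} \<Longrightarrow> distr M borel (U i) = N"
    and atomless: "\<And>x. emeasure N {x} = 0"
  shows "distr M (count_space UNIV) (\<lambda>\<omega>. rank_perm n (\<lambda>i. U i \<omega>))
       = measure_pmf (pmf_of_set {\<alpha>. \<alpha> permutes {1..n}})"
proof (rule prob_space_eq_pmf_of_set)
  let ?I = "{1..n}" and ?C = "count_space UNIV"
  let ?\<rho> = "\<lambda>\<omega>. rank_perm n (\<lambda>i. U i \<omega>)" and ?B = "Pi\<^sub>M {1..n} (\<lambda>_. borel)"
  have rv [measurable]: "random_variable borel (U i)" if "i \<in> ?I" for i
    using indep that by (simp add: indep_vars_def)
  have \<rho>_rv [measurable]: "?\<rho> \<in> measurable M ?C" by (rule rank_perm_measurable[OF rv])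
  show "prob_space (distr M ?C ?\<rho>)" by (rule prob_space_distr) (rule \<rho>_rv)
  show "finite {\<alpha>. \<alpha> permutes ?I}" by (simp add: finite_permutations)
  have "AE \<omega> in M. inj_on (\<lambda>i. U i \<omega>) ?I"
    using indep law atomless by (intro AE_inj_on_if_indep_vars) auto
  then have "AE \<omega> in M. ?\<rho> \<omega> permutes ?I" by eventually_elim (rule rank_perm_permutes)
  then show "AE \<alpha> in distr M ?C ?\<rho>. \<alpha> \<in> {\<alpha>. \<alpha> permutes ?I}"
    by (subst AE_distr_iff) auto
  fix \<alpha> \<beta> assume "\<alpha> \<in> {\<alpha>. \<alpha> permutes ?I}" "\<beta> \<in> {\<alpha>. \<alpha> permutes ?I}"
  then have \<alpha>: "\<alpha> permutes ?I" and \<beta>: "\<beta> permutes ?I" by simp_all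
  show "measure (distr M ?C ?\<rho>) {\<alpha>} = measure (distr M ?C ?\<rho>) {\<beta>}"
  proof (cases "?I = {}")
    case True
    then show ?thesis using \<alpha> \<beta> by simp
  next
    case False
    define \<pi> where "\<pi> = inv \<beta> \<circ> \<alpha>"
    have \<pi>: "\<pi> permutes ?I"
      unfolding \<pi>_def using \<alpha> \<beta> by (intro permutes_compose permutes_inv)
    have \<rho>_B: "rank_perm n \<in> measurable ?B ?C"
      using rank_perm_measurable[of n "\<lambda>i f. f i" ?B] by simp
    have law_of_ranks: "distr M ?C (\<lambda>\<omega>. rank_perm n (\<lambda>i. V i \<omega>))
        = distr (distr M ?B (\<lambda>\<omega>. \<lambda>i\<in>?I. V i \<omega>)) ?C (rank_perm n)"
      if V: "\<And>i. i \<in> ?I \<Longrightarrow> random_variable borel (V i)" for V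
    proof -
      have "rank_perm n (\<lambda>i\<in>?I. V i \<omega>) = rank_perm n (\<lambda>i. V i \<omega>)" for \<omega>
        by (rule rank_perm_cong) simp
      then show ?thesis
        using V by (subst distr_distr[OF \<rho>_B]) (auto intro!: measurable_restrict simp: comp_def)
    qed
    have "distr M ?C (\<lambda>\<omega>. rank_perm n (\<lambda>i. U (\<pi> i) \<omega>)) = distr M ?C ?\<rho>"
    proof -
      have "random_variable borel (U (\<pi> i))" if "i \<in> ?I" for i
        using that by (intro rv) (simp only: permutes_in_image[OF \<pi>])
      then show ?thesis
        using iid_exchangeable[OF False indep law \<pi>] rv by (simp only: law_of_ranks)
    qed
    then have shifted: "distr M ?C (\<lambda>\<omega>. ?\<rho> \<omega> \<circ> \<pi>) = distr M ?C ?\<rho>"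
      by (simp only: rank_perm_reindex[OF \<pi>, of "\<lambda>i. U i \<omega>" for \<omega>])
    have "f \<circ> \<pi> = \<alpha> \<longleftrightarrow> f = \<beta>" for f
    proof
      assume "f \<circ> \<pi> = \<alpha>"
      moreover have "f = (f \<circ> \<pi>) \<circ> (inv \<alpha> \<circ> \<beta>)"
        by (simp add: fun_eq_iff \<pi>_def permutes_inverses[OF \<alpha>] permutes_inverses[OF \<beta>])
      ultimately show "f = \<beta>"
        by (simp add: fun_eq_iff permutes_inverses[OF \<alpha>])
    qed (simp add: \<pi>_def fun_eq_iff permutes_inverses[OF \<beta>])
    then have "measure (distr M ?C (\<lambda>\<omega>. ?\<rho> \<omega> \<circ> \<pi>)) {\<alpha>} = measure (distr M ?C ?\<rho>) {\<beta>}"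
      by (subst (1 2) measure_distr)
        (auto intro!: arg_cong[where f = prob] measurable_compose[OF \<rho>_rv])
    then show ?thesis unfolding shifted .
  qed
qed simp

section \<open>The permutation of the random point set\<close>

theorem lemma1p3:
  fixes n :: nat and t s :: "nat \<Rightarrow> nat"
    and M :: "'a measure" and U :: "nat \<Rightarrow> 'a \<Rightarrow> real"
    and Z :: "nat \<Rightarrow> 'a \<Rightarrow> real \<times> real" and P :: "'a \<Rightarrow> (real \<times> real) set"
    and \<tau> :: "'a \<Rightarrow> nat \<Rightarrow> nat"
  assumes "cycle_type n t"
    and "type_cyclic n t s"
    and "prob_space M"
    and "prob_space.indep_vars M (\<lambda>_. borel) U {1..n}"
    and "\<And>i. i \<in> {1..n} \<Longrightarrow> distr M borel (U i) = uniform_measure lborel {0..1}"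
  defines "Z \<equiv> \<lambda>i \<omega>. (U i \<omega>, U (s i) \<omega>)"
    and "P \<equiv> \<lambda>\<omega>. {Z i \<omega> | i. i \<in> {1..n}}"
    and "\<tau> \<equiv> \<lambda>\<omega>. Perm (P \<omega>)"
  shows "(AE \<omega> in M. card (P \<omega>) = n \<and> distinct_coordinates (P \<omega>))
    \<and> \<tau> \<in> measurable M (count_space UNIV)
    \<and> distr M (count_space UNIV) \<tau> = measure_pmf (pmf_of_set {\<sigma>. type_cyclic n t \<sigma>})"
proof -
  interpret prob_space M by fact
  let ?I = "{1..n}" and ?C = "count_space UNIV"
  define \<rho> where "\<rho> \<omega> = rank_perm n (\<lambda>i. U i \<omega>)" for \<omega>
  define conj where "conj \<alpha> = \<alpha> \<circ> s \<circ> inv \<alpha>" for \<alpha> :: "nat \<Rightarrow> nat"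
  have s: "s permutes ?I" using assms(2) by (simp add: type_cyclic_def)
  have rv: "random_variable borel (U i)" if "i \<in> ?I" for i
    using assms(4) that by (simp add: indep_vars_def)
  have P: "P \<omega> = points n s (\<lambda>i. U i \<omega>)" for \<omega>
    by (auto simp: P_def Z_def)
  have atomless: "emeasure (uniform_measure lborel {0..1}) {x} = 0" for x :: real
  proof -
    have "emeasure lborel ({0..1} \<inter> {x}) \<le> emeasure lborel {x}"
      by (rule emeasure_mono) auto
    then show ?thesis by simp
  qed
  have distinct: "AE \<omega> in M. inj_on (\<lambda>i. U i \<omega>) ?I"
    using assms(4,5) atomless by (intro AE_inj_on_if_indep_vars) auto
  have \<rho>_rv: "\<rho> \<in> measurable M ?C"
    unfolding \<rho>_def by (rule rank_perm_measurable[OF rv])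
  have \<tau>_rv: "\<tau> \<in> measurable M ?C"
    unfolding \<tau>_def P
  proof (rule measurable_if_determined_by_order[of ?I U])
    fix \<omega> \<omega>' assume "\<And>i j. i \<in> ?I \<Longrightarrow> j \<in> ?I \<Longrightarrow> U i \<omega> \<le> U j \<omega> \<longleftrightarrow> U i \<omega>' \<le> U j \<omega>'"
    then show "Perm (points n s (\<lambda>i. U i \<omega>)) = Perm (points n s (\<lambda>i. U i \<omega>'))"
      by (rule Perm_points_cong[OF s])
  qed (simp_all only: rv finite_atLeastAtMost)
  have "distr M ?C \<tau> = distr M ?C (\<lambda>\<omega>. conj (\<rho> \<omega>))"
  proof (rule distr_cong_AE[OF refl refl])
    show "AE \<omega> in M. \<tau> \<omega> = conj (\<rho> \<omega>)"
      using distinct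
    proof eventually_elim
      fix \<omega> assume "inj_on (\<lambda>i. U i \<omega>) ?I"
      from Perm_points_eq_conjugate[OF s this] show "\<tau> \<omega> = conj (\<rho> \<omega>)"
        by (simp only: \<tau>_def P \<rho>_def conj_def)
    qed
  qed (use \<tau>_rv \<rho>_rv in \<open>auto intro: measurable_compose[OF \<rho>_rv]\<close>)
  also have "\<dots> = distr (distr M ?C \<rho>) ?C conj"
    using \<rho>_rv by (subst distr_distr) (auto simp: comp_def)
  also have "distr M ?C \<rho> = measure_pmf (pmf_of_set {\<alpha>. \<alpha> permutes ?I})"
    unfolding \<rho>_def using assms(4,5) atomless by (rule rank_perm_uniform)
  also have "distr (measure_pmf (pmf_of_set {\<alpha>. \<alpha> permutes ?I})) ?C conj
      = measure_pmf (map_pmf conj (pmf_of_set {\<alpha>. \<alpha> permutes ?I}))"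
    by (rule map_pmf_rep_eq[symmetric])
  also have "map_pmf conj (pmf_of_set {\<alpha>. \<alpha> permutes ?I}) = pmf_of_set {\<sigma>. type_cyclic n t \<sigma>}"
    unfolding conj_def by (rule random_conjugate_uniform[OF assms(2)])
  finally have "distr M ?C \<tau> = measure_pmf (pmf_of_set {\<sigma>. type_cyclic n t \<sigma>})" .
  moreover have "AE \<omega> in M. card (P \<omega>) = n \<and> distinct_coordinates (P \<omega>)"
    using distinct
  proof eventually_elim
    fix \<omega> assume "inj_on (\<lambda>i. U i \<omega>) ?I"
    from points_distinct_coordinates[OF s this]
    show "card (P \<omega>) = n \<and> distinct_coordinates (P \<omega>)" by (simp only: P)
  qed
  ultimately show ?thesis using \<tau>_rv by blast
qed

end
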